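(* Consider the problem $\min_{x\in\mathbb{R}^n}\{f(x)+g(x): Ax-b=0\}$ under the assumptions stated in the context, and let $\{(x^k,\mu^k)\}_{k\in\mathbb{N}}$ be generated by UDD-ALM (with parameters $x^0\in X$, $\mu^0\in\mathbb{R}^m$, $\rho\ge0$, $\varrho>0$, $\theta>1$). Let $x^*$ be a limit point of $\{x^k\}_{k\in\mathbb{N}}$ that satisfies the modified Robinson's condition. Then: 1. (Asymptotic convergence) $x^*$ is a stationary point of the problem. 2. (Iteration complexity) Let $\epsilon>0$ and define $$\delta_1:=\min\left\{\frac{(2\theta-1)L_{\mathcal K}}{2},\varrho\right\},\qquad \delta_2:=(\theta+1)L_{\mathcal K}+(\rho+\varrho)\|A\| .$$ Then UDD-ALM finds an $\epsilon$-stationary point in at most $K$ iterations (that is, at least one of $x^0,\dots,x^K$ is $\epsilon$-stationary), where $$K\le\left\lceil\frac{\max\{1,\delta_2\}^2\left(\mathcal{L}_\rho(x^0,\mu^0)-f(x^* )-g(x^* )\right)}{\delta_1\epsilon^2}\right\rceil=\mathcal{O}(\epsilon^{-2}).$$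
   Context: **Assumptions.** (1) $g=g_0+\delta_X$, where $X\subseteq\mathbb{R}^n$ is convex and compact, $\delta_X$ is its $0/\infty$ indicator function, and $g_0:\mathbb{R}^n\to\mathbb{R}$ is continuous and convex over $X$. (2) $f:\mathbb{R}^n\to\mathbb{R}$ has $L_f$-Lipschitz gradient over $X$ ($L_f>0$). (3) $A\in\mathbb{R}^{m\times n}$, $b\in\mathbb{R}^m$, and $X\cap\{x:Ax=b\}\ne\emptyset$. **Augmented Lagrangian.** $\mathcal{L}_\rho(x,\mu)=f(x)+g(x)+\langle\mu,Ax-b\rangle+\frac{\rho}{2}\|Ax-b\|^2$. **Algorithm UDD-ALM.** Initialize $x^0\in X$, $\mu^0\in\mathbb{R}^m$, $\rho\ge0$, $\varrho>0$, $\theta>1$; set $L_{\mathcal K}=L_f+\rho\|A^\top A\|$ (spectral norm). For $k=0,1,2,\dots$: $$x^{k+1}=\arg\min_{x\in\mathbb{R}^n} g(x)+\langle\nabla f(x^k)+A^\top(\mu^k+\rho(Ax^k-b)),x-x^k\rangle+\tfrac{\theta L_{\mathcal K}}{2}\|x-x^k\|^2,$$ $$\mu^{k+1}=\mu^k-\varrho(Ax^{k+1}-b).$$ **Stationarity.** For $\epsilon\geq 0$, $x\in X$ is an $\epsilon$-stationary point if there is $\lambda\in\mathbb{R}^m$ with $\mathrm{dist}(-\nabla f(x)-A^\top\lambda,\partial g(x))\le\epsilon$ and $\|Ax-b\|\le\epsilon$; a stationary point is the case $\epsilon=0$ (i.e. $-\nabla f(x)-A^\top\lambda\in\partial g(x)$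 for some $\lambda$, and $Ax=b$). Here $\mathrm{dist}(z,S)=\inf_{y\in S}\|y-z\|$. **Modified Robinson's condition.** $x\in X$ satisfies it if $\{Ad: d\in T_X(x)\}=\mathbb{R}^m$, where $T_X(x)$ is the tangent cone $\{d: d=\lim_{k\to\infty}(x^k-x)/\tau_k,\ x^k\to x,\ \tau_k\downarrow0,\ x^k\in X\}$ (feasibility $Ax=b$ is not required). *)

theory Defs
  imports "HOL-Analysis.Analysis" "HOL-Library.Landau_Symbols"
begin

definition gradient :: "('a::real_inner \<Rightarrow> real) \<Rightarrow> 'a \<Rightarrow> 'a" where
  "gradient f x = (THE D. GDERIV f x :> D)"

definition indicator_fun :: "'a set \<Rightarrow> 'a \<Rightarrow> ereal" where
  "indicator_fun X x = (if x \<in> X then 0 else \<infinity>)"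

definition subdifferential :: "('a::real_inner \<Rightarrow> ereal) \<Rightarrow> 'a \<Rightarrow> 'a set" where
  "subdifferential g x =
     {v. \<bar>g x\<bar> \<noteq> \<infinity> \<and> (\<forall>y. g x + ereal (v \<bullet> (y - x)) \<le> g y)}"

text \<open>Extended-real-valued, so that the distance to the empty set is \<open>\<infinity>\<close>;
  the library's \<^const>\<open>infdist\<close> would give 0 there.\<close>

definition dist_to_set :: "'a::real_normed_vector \<Rightarrow> 'a set \<Rightarrow> ereal" where
  "dist_to_set z S = (INF y\<in>S. ereal (norm (y - z)))"

text \<open>The norm that the library puts on \<^typ>\<open>real^'n^'m\<close> is the Frobenius norm;
  the spectral norm is the operator norm.\<close>

definition spectral_norm :: "real^'n^'m \<Rightarrow> real" where
  "spectral_norm A = onorm (\<lambda>x. A *v x)"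

definition tangent_cone :: "'a::real_normed_vector set \<Rightarrow> 'a \<Rightarrow> 'a set" where
  "tangent_cone X x =
     {d. \<exists>(xs :: nat \<Rightarrow> 'a) (\<tau> :: nat \<Rightarrow> real).
           (\<forall>k. xs k \<in> X) \<and> xs \<longlonglongrightarrow> x \<and>
           (\<forall>k. \<tau> k > 0) \<and> decseq \<tau> \<and> \<tau> \<longlonglongrightarrow> 0 \<and>
           (\<lambda>k. (xs k - x) /\<^sub>R \<tau> k) \<longlonglongrightarrow> d}"

definition modified_Robinson :: "(real^'n) set \<Rightarrow> real^'n^'m \<Rightarrow> real^'n \<Rightarrow> bool" where
  "modified_Robinson X A x \<longleftrightarrow> x \<in> X \<and> {A *v d | d. d \<in> tangent_cone X x} = UNIV"

definition augmented_Lagrangian ::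
  "(real^'n \<Rightarrow> real) \<Rightarrow> (real^'n \<Rightarrow> ereal) \<Rightarrow> real^'n^'m \<Rightarrow> real^'m \<Rightarrow> real
     \<Rightarrow> real^'n \<Rightarrow> real^'m \<Rightarrow> ereal" where
  "augmented_Lagrangian f g A b \<rho> x \<mu> =
     ereal (f x) + g x + ereal (\<mu> \<bullet> (A *v x - b)) + ereal (\<rho> / 2 * (norm (A *v x - b))\<^sup>2)"

definition L_K :: "real \<Rightarrow> real \<Rightarrow> real^'n^'m \<Rightarrow> real" where
  "L_K Lf \<rho> A = Lf + \<rho> * spectral_norm (transpose A ** A)"

definition UDD_ALM ::
  "(real^'n \<Rightarrow> real) \<Rightarrow> (real^'n \<Rightarrow> ereal) \<Rightarrow> real^'n^'m \<Rightarrow> real^'m \<Rightarrow> real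
     \<Rightarrow> real \<Rightarrow> real \<Rightarrow> real \<Rightarrow> (nat \<Rightarrow> real^'n) \<Rightarrow> (nat \<Rightarrow> real^'m) \<Rightarrow> bool" where
  "UDD_ALM f g A b Lf \<rho> \<rho>\<^sub>d \<theta> x \<mu> \<longleftrightarrow>
     (\<forall>k. is_arg_min
            (\<lambda>z. g z
               + ereal ((gradient f (x k) + transpose A *v (\<mu> k + \<rho> *\<^sub>R (A *v x k - b))) \<bullet> (z - x k))
               + ereal (\<theta> * L_K Lf \<rho> A / 2 * (norm (z - x k))\<^sup>2))
            (\<lambda>_. True) (x (Suc k)) \<and>
          \<mu> (Suc k) = \<mu> k - \<rho>\<^sub>d *\<^sub>R (A *v x (Suc k) - b))"

definition eps_stationary ::
  "(real^'n \<Rightarrow> real) \<Rightarrow> (real^'n \<Rightarrow> ereal) \<Rightarrow> (real^'n) set \<Rightarrow> real^'n^'m \<Rightarrow> real^'m \<Rightarrow> real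
     \<Rightarrow> real^'n \<Rightarrow> bool" where
  "eps_stationary f g X A b \<epsilon> x \<longleftrightarrow>
     x \<in> X \<and>
     (\<exists>l :: real^'m.
        dist_to_set (- gradient f x - transpose A *v l) (subdifferential g x) \<le> ereal \<epsilon> \<and>
        norm (A *v x - b) \<le> \<epsilon>)"

definition stationary ::
  "(real^'n \<Rightarrow> real) \<Rightarrow> (real^'n \<Rightarrow> ereal) \<Rightarrow> (real^'n) set \<Rightarrow> real^'n^'m \<Rightarrow> real^'m
     \<Rightarrow> real^'n \<Rightarrow> bool" where
  "stationary f g X A b x \<longleftrightarrow>
     x \<in> X \<and>
     (\<exists>l :: real^'m. - gradient f x - transpose A *v l \<in> subdifferential g x) \<and>
     A *v x = b"

lemma GDERIV_gradient:
  fixes f :: "'a::euclidean_space \<Rightarrow> real"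
  assumes "f differentiable at x"
  shows "GDERIV f x :> gradient f x"
proof -
  obtain f' where f': "(f has_derivative f') (at x)"
    using assms by (auto simp: differentiable_def)
  then interpret bounded_linear f' by (rule has_derivative_bounded_linear)
  define D0 where "D0 = adjoint f' 1"
  have "f' = (\<lambda>h. h \<bullet> D0)"
    unfolding D0_def using adjoint_works[OF linear_axioms, of _ 1] by (intro ext) simp
  with f' have ex: "GDERIV f x :> D0"
    unfolding gderiv_def by (simp only:)
  have uniq: "D = D'" if "GDERIV f x :> D" "GDERIV f x :> D'" for D D'
  proof -
    have "(\<lambda>h. h \<bullet> D) = (\<lambda>h. h \<bullet> D')"
      using that unfolding gderiv_def by (rule has_derivative_unique)
    then have "\<forall>h. h \<bullet> D = h \<bullet> D'" by (simp add: fun_eq_iff)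
    then show ?thesis by (simp only: vector_eq_ldot)
  qed
  show ?thesis
    unfolding gradient_def by (rule theI[where P = "gderiv f x", OF ex uniq[OF _ ex]])
qed

lemma closed_subdifferential: "closed (subdifferential g x)"
proof (cases "\<bar>g x\<bar> = \<infinity>")
  case True
  then show ?thesis by (simp add: subdifferential_def)
next
  case False
  then obtain r where r: "g x = ereal r" by (cases "g x") auto
  have "subdifferential g x = (\<Inter>y. {v. ereal (r + v \<bullet> (y - x)) \<le> g y})"
    by (auto simp: subdifferential_def r)
  moreover have "closed {v. ereal (r + v \<bullet> (y - x)) \<le> g y}" for y
    by (intro closed_Collect_le continuous_intros)
  ultimately show ?thesis by auto
qed

lemma stationary_iff_eps_stationary_0:
  "stationary f g X A b x \<longleftrightarrow> eps_stationary f g X A b 0 x"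
proof -
  have *: "z \<in> S \<longleftrightarrow> dist_to_set z S \<le> 0" if "closed S" for z :: "real^'n" and S
  proof
    assume "z \<in> S"
    then show "dist_to_set z S \<le> 0"
      unfolding dist_to_set_def by (intro INF_lower2[of z]) auto
  next
    assume le: "dist_to_set z S \<le> 0"
    have "\<exists>y\<in>S. dist y z < e" if "e > 0" for e
    proof -
      have "dist_to_set z S < ereal e" using le that by (simp add: order_le_less_trans)
      then show ?thesis by (auto simp: dist_to_set_def INF_less_iff dist_norm)
    qed
    then show "z \<in> S" using closed_approachable[OF that] by blast
  qed
  show ?thesis
    unfolding stationary_def eps_stationary_def *[OF closed_subdifferential]
    by (auto simp only: zero_ereal_def[symmetric] norm_le_zero_iff right_minus_eq)
qed

end

theory Submission
  imports Defs
begin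

text \<open>The dual step moves against the constraint residual, so the augmented Lagrangian decreases along
  both the primal and the dual step, by at least \<open>\<delta>\<^sub>1\<close> times the squared step length plus the squared
  residual. What has to be excluded is that it decreases to \<open>-\<infinity>\<close>. The optimality condition of the primal
  step bounds \<open>\<langle>\<mu>\<^sup>k, A(y - x\<^sup>k\<^sup>+\<^sup>1)\<rangle>\<close> from below uniformly in \<open>y \<in> X\<close> and \<open>k\<close>. If the multipliers
  were unbounded along a subsequence with \<open>x\<^sup>k\<^sup>+\<^sup>1 \<rightarrow> x\<^sup>*\<close>, then a limit \<open>u\<close> of the normalised multipliers would
  satisfy \<open>\<langle>u, A d\<rangle> \<ge> 0\<close> on the tangent cone at \<open>x\<^sup>*\<close>, contradicting the modified Robinson condition.
  Hence the Lagrangian converges along a subsequence, and by monotonicity it is bounded below by the limit;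
  steps and residuals are square summable, so the limit is \<open>f(x\<^sup>*) + g(x\<^sup>*)\<close>, and passing to the limit in the
  optimality condition gives stationarity.\<close>

section \<open>Spectral norm estimates\<close>

lemma spectral_norm_nonneg: "0 \<le> spectral_norm A"
  unfolding spectral_norm_def by (intro onorm_pos_le matrix_vector_mul_bounded_linear)

lemma norm_matrix_vector_le: "norm (A *v x) \<le> spectral_norm A * norm x"
  unfolding spectral_norm_def by (intro onorm matrix_vector_mul_bounded_linear)

lemma inner_transpose: "(transpose A *v y) \<bullet> x = y \<bullet> (A *v x)" for A :: "real^'n^'m"
  by (simp add: dot_lmul_matrix transpose_matrix_vector)

lemma norm_transpose_vector_le: "norm (transpose A *v y) \<le> spectral_norm A * norm y"
  for A :: "real^'n^'m"
proof (cases "transpose A *v y = 0")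
  case True
  then show ?thesis by (simp add: spectral_norm_nonneg)
next
  case False
  let ?w = "transpose A *v y"
  have "norm ?w * norm ?w = ?w \<bullet> ?w"
    by (simp add: norm_eq_sqrt_inner)
  also have "\<dots> = y \<bullet> (A *v ?w)"
    by (rule inner_transpose)
  also have "\<dots> \<le> norm y * norm (A *v ?w)"
    by (rule norm_cauchy_schwarz)
  also have "\<dots> \<le> norm y * (spectral_norm A * norm ?w)"
    by (intro mult_left_mono norm_matrix_vector_le) auto
  finally have "norm ?w * norm ?w \<le> (spectral_norm A * norm y) * norm ?w"
    by (simp add: mult_ac)
  then show ?thesis
    using False by simp
qed

text \<open>Going through the quadratic form of \<open>transpose A ** A\<close> yields the constant
  that appears in \<open>L_K\<close>, so that the penalty term has the curvature bound the algorithm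
  uses.\<close>

lemma norm_matrix_vector_square_le:
  fixes A :: "real^'n^'m"
  shows "(norm (A *v d))\<^sup>2 \<le> spectral_norm (transpose A ** A) * (norm d)\<^sup>2"
proof -
  have "(norm (A *v d))\<^sup>2 = (transpose A *v (A *v d)) \<bullet> d"
    unfolding inner_transpose power2_norm_eq_inner ..
  also have "\<dots> = ((transpose A ** A) *v d) \<bullet> d"
    by (simp add: matrix_vector_mul_assoc)
  also have "\<dots> \<le> norm ((transpose A ** A) *v d) * norm d"
    by (rule norm_cauchy_schwarz)
  also have "\<dots> \<le> (spectral_norm (transpose A ** A) * norm d) * norm d"
    by (intro mult_right_mono norm_matrix_vector_le) auto
  finally show ?thesis by (simp add: power2_eq_square mult_ac)
qed

section \<open>Quadratic upper bound and optimality of a proximal step\<close>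

lemma descent_lemma:
  fixes f :: "'a::euclidean_space \<Rightarrow> real"
  assumes "convex X" and diff: "\<And>z. z \<in> X \<Longrightarrow> f differentiable at z"
    and lip: "L-lipschitz_on X (gradient f)" and "p \<in> X" "q \<in> X"
  shows "f q \<le> f p + gradient f p \<bullet> (q - p) + L / 2 * (norm (q - p))\<^sup>2"
proof -
  define d where "d = q - p"
  \<comment> \<open>Along the segment, \<open>f\<close> minus the non-constant terms of its
    quadratic model at \<open>p\<close>. The Lipschitz bound makes the derivative nonpositive on
    [0,1], and comparing the endpoints gives the claim without integration.\<close>
  define \<phi> where "\<phi> t = f (p + t *\<^sub>R d) - t * (gradient f p \<bullet> d) - L / 2 * t\<^sup>2 * (norm d)\<^sup>2" for t
  have seg: "p + t *\<^sub>R d \<in> X" if "0 \<le> t" "t \<le> 1" for t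
  proof -
    have "p + t *\<^sub>R d = (1 - t) *\<^sub>R p + t *\<^sub>R q"
      by (simp add: d_def algebra_simps)
    then show ?thesis
      using that assms by (simp add: convexD)
  qed
  have deriv: "\<exists>y. DERIV \<phi> t :> y \<and> y \<le> 0" if t: "0 \<le> t" "t \<le> 1" for t
  proof (intro exI conjI)
    let ?G = "gradient f (p + t *\<^sub>R d)"
    have "GDERIV f (p + t *\<^sub>R d) :> ?G"
      by (intro GDERIV_gradient diff seg t)
    then have f': "(f has_derivative (\<lambda>h. h \<bullet> ?G)) (at (p + t *\<^sub>R d))"
      by (simp add: gderiv_def)
    have "((\<lambda>s. p + s *\<^sub>R d) has_derivative (\<lambda>h. h *\<^sub>R d)) (at t)"
      by (auto intro!: derivative_eq_intros)
    from has_derivative_compose[OF this f']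
    have "((\<lambda>s. f (p + s *\<^sub>R d)) has_derivative (\<lambda>h. (h *\<^sub>R d) \<bullet> ?G)) (at t)" .
    moreover have "(\<lambda>h. (h *\<^sub>R d) \<bullet> ?G) = (*) (?G \<bullet> d)"
      by (auto simp: inner_commute)
    ultimately have "((\<lambda>s. f (p + s *\<^sub>R d)) has_field_derivative (?G \<bullet> d)) (at t)"
      by (simp only: has_field_derivative_def)
    then show "DERIV \<phi> t :> ?G \<bullet> d - gradient f p \<bullet> d - L * t * (norm d)\<^sup>2"
      unfolding \<phi>_def by (auto intro!: derivative_eq_intros)
    have "?G \<bullet> d - gradient f p \<bullet> d = (?G - gradient f p) \<bullet> d"
      by (simp add: inner_diff_left)
    also have "\<dots> \<le> norm (?G - gradient f p) * norm d"
      by (rule norm_cauchy_schwarz)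
    also have "\<dots> \<le> (L * norm (t *\<^sub>R d)) * norm d"
      using lipschitz_onD[OF lip seg[OF t] \<open>p \<in> X\<close>]
      by (intro mult_right_mono) (auto simp: dist_norm)
    also have "\<dots> = L * t * (norm d)\<^sup>2"
      using t by (simp add: power2_eq_square)
    finally show "?G \<bullet> d - gradient f p \<bullet> d - L * t * (norm d)\<^sup>2 \<le> 0"
      by simp
  qed
  have "\<phi> 1 \<le> \<phi> 0"
    by (rule DERIV_nonpos_imp_nonincreasing) (use deriv in auto)
  then show ?thesis
    by (simp add: \<phi>_def d_def)
qed

lemma nonneg_of_linear_plus_quadratic:
  fixes a c :: real
  assumes "\<And>t. 0 < t \<Longrightarrow> t \<le> 1 \<Longrightarrow> 0 \<le> t * a + t\<^sup>2 * c"
  shows "0 \<le> a"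
proof (rule tendsto_lowerbound)
  show "((\<lambda>t. a + t * c) \<longlongrightarrow> a) (at_right 0)"
    by (auto intro!: tendsto_eq_intros)
  have "0 \<le> a + t * c" if "0 < t" "t < 1" for t
  proof -
    have "0 \<le> t * (a + t * c)"
      using assms[of t] that by (simp add: algebra_simps power2_eq_square)
    then show ?thesis
      using that by (simp add: zero_le_mult_iff)
  qed
  then show "\<forall>\<^sub>F t in at_right 0. 0 \<le> a + t * c"
    using eventually_at_right_less[of "0::real"] eventually_at_right_field[of _ "0::real"]
    by (auto intro!: exI[of _ 1])
qed auto

text \<open>Compare the minimizer \<open>q\<close> with \<open>q + t *\<^sub>R (y - q)\<close>.
  Convexity makes the change of \<open>h\<close> at most linear in \<open>t\<close>, and the squared
  norm adds only a term of second order, so dividing by \<open>t\<close> and letting it tend to 0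
  leaves the first-order condition.\<close>

lemma proximal_step_optimality:
  fixes h :: "'a::real_inner \<Rightarrow> real"
  assumes "convex X" "convex_on X h" "q \<in> X" "y \<in> X"
    and min: "\<And>z. z \<in> X \<Longrightarrow>
      h q + v \<bullet> (q - p) + c / 2 * (norm (q - p))\<^sup>2 \<le> h z + v \<bullet> (z - p) + c / 2 * (norm (z - p))\<^sup>2"
  shows "h q \<le> h y + v \<bullet> (y - q) + c * ((q - p) \<bullet> (y - q))"
proof -
  define w where "w = y - q"
  have "0 \<le> h y - h q + v \<bullet> w + c * ((q - p) \<bullet> w)"
  proof (rule nonneg_of_linear_plus_quadratic)
    fix t :: real assume t: "0 < t" "t \<le> 1"
    let ?z = "q + t *\<^sub>R w"
    have z: "?z = (1 - t) *\<^sub>R q + t *\<^sub>R y"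
      by (simp add: w_def algebra_simps)
    have "?z \<in> X"
      unfolding z using t assms by (simp add: convexD)
    have "h ?z \<le> (1 - t) * h q + t * h y"
      unfolding z using convex_onD[OF assms(2), of t q y] t assms by auto
    moreover have "c / 2 * (norm (?z - p))\<^sup>2 =
        c / 2 * (norm (q - p))\<^sup>2 + t * (c * ((q - p) \<bullet> w)) + t\<^sup>2 * (c / 2 * (norm w)\<^sup>2)"
      unfolding power2_norm_eq_inner
      by (simp add: inner_simps inner_commute field_simps power2_eq_square)
    moreover have "v \<bullet> (?z - p) = v \<bullet> (q - p) + t * (v \<bullet> w)"
      by (simp add: inner_simps)
    ultimately show "0 \<le> t * (h y - h q + v \<bullet> w + c * ((q - p) \<bullet> w)) + t\<^sup>2 * (c / 2 * (norm w)\<^sup>2)"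
      using min[OF \<open>?z \<in> X\<close>]
      by (simp only: distrib_left right_diff_distrib left_diff_distrib mult_1_left)
  qed
  then show ?thesis by (simp add: w_def)
qed

section \<open>Tangent cone and boundedness of multipliers\<close>

lemma tangent_cone_inner_nonneg:
  fixes A :: "real^'n^'m"
  assumes "\<And>y. y \<in> X \<Longrightarrow> 0 \<le> u \<bullet> (A *v (y - z))" and "d \<in> tangent_cone X z"
  shows "0 \<le> u \<bullet> (A *v d)"
proof -
  obtain xs :: "nat \<Rightarrow> real^'n" and \<tau> :: "nat \<Rightarrow> real"
    where xs: "\<And>k. xs k \<in> X" "\<And>k. \<tau> k > 0" "(\<lambda>k. (xs k - z) /\<^sub>R \<tau> k) \<longlonglongrightarrow> d"
    using assms(2) unfolding tangent_cone_def by auto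
  have "(\<lambda>k. u \<bullet> (A *v ((xs k - z) /\<^sub>R \<tau> k))) \<longlonglongrightarrow> u \<bullet> (A *v d)"
    by (intro tendsto_intros bounded_linear.tendsto[OF matrix_vector_mul_bounded_linear] xs)
  moreover have "0 \<le> u \<bullet> (A *v ((xs k - z) /\<^sub>R \<tau> k))" for k
    using assms(1)[OF xs(1)[of k]] xs(2)[of k]
    by (simp add: matrix_vector_mult_scaleR)
  ultimately show ?thesis
    by (intro LIMSEQ_le_const) auto
qed

lemma modified_Robinson_bounded_multipliers:
  fixes A :: "real^'n^'m" and \<nu> :: "nat \<Rightarrow> real^'m"
  assumes R: "modified_Robinson X A zs" and z: "z \<longlonglongrightarrow> zs"
    and low: "\<And>j y. y \<in> X \<Longrightarrow> - C \<le> \<nu> j \<bullet> (A *v (y - z j))"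
  shows "bounded (range \<nu>)"
proof (rule ccontr)
  assume "\<not> bounded (range \<nu>)"
  then have nb: "\<not> Bseq \<nu>"
    by (simp add: Bseq_eq_bounded)
  \<comment> \<open>Requiring \<open>j \<ge> n\<close> as well makes the selected indices tend to
    infinity, so the matching points \<open>z\<close> still converge to \<open>zs\<close>. The
    selection need not be monotone.\<close>
  have "\<exists>j\<ge>n. norm (\<nu> j) > real n" for n
  proof (rule ccontr)
    assume "\<not> (\<exists>j\<ge>n. norm (\<nu> j) > real n)"
    then have "\<forall>\<^sub>F j in sequentially. norm (\<nu> j) \<le> real n"
      by (auto simp: eventually_sequentially not_less)
    then have "Bseq \<nu>"
      by (rule BfunI)
    with nb show False by simp
  qed
  then obtain s where s: "\<And>n. s n \<ge> n" "\<And>n. norm (\<nu> (s n)) > real n"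
    by metis
  define w where "w n = \<nu> (s n) /\<^sub>R norm (\<nu> (s n))" for n
  have pos: "norm (\<nu> (s n)) > 0" for n
    using s(2)[of n] by (meson of_nat_0_le_iff le_less_trans)
  have "norm (w n) = 1" for n
    using pos[of n] by (simp add: w_def)
  then have "\<forall>n. w n \<in> sphere 0 1"
    by simp
  then obtain u t where u: "u \<in> sphere 0 1" "strict_mono (t :: nat \<Rightarrow> nat)" "(w \<circ> t) \<longlonglongrightarrow> u"
    using compact_sphere[of "0 :: real^'m" 1] unfolding compact_def by blast
  have "filterlim s at_top sequentially"
    using s(1) by (auto simp: filterlim_at_top eventually_sequentially intro: order_trans)
  then have "filterlim (s \<circ> t) at_top sequentially"
    using filterlim_compose filterlim_subseq[OF u(2)] unfolding o_def by blast
  then have zst: "(\<lambda>n. z (s (t n))) \<longlonglongrightarrow> zs"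
    using filterlim_compose[OF z] by (simp add: o_def)
  have inv0: "(\<lambda>n. C / real (t n)) \<longlonglongrightarrow> 0"
    using LIMSEQ_subseq_LIMSEQ[OF lim_const_over_n[of C] u(2)] by (simp add: o_def)
  have nn: "0 \<le> u \<bullet> (A *v (y - zs))" if y: "y \<in> X" for y
  proof -
    have "(\<lambda>n. w (t n) \<bullet> (A *v (y - z (s (t n))))) \<longlonglongrightarrow> u \<bullet> (A *v (y - zs))"
      using u(3) unfolding o_def
      by (intro tendsto_intros bounded_linear.tendsto[OF matrix_vector_mul_bounded_linear] zst)
    moreover have "(\<lambda>n. - \<bar>C\<bar> / real (t n)) \<longlonglongrightarrow> 0"
      using tendsto_minus[OF tendsto_rabs[OF inv0]] by (simp add: abs_divide)
    moreover have "\<exists>N. \<forall>n\<ge>N. - \<bar>C\<bar> / real (t n) \<le> w (t n) \<bullet> (A *v (y - z (s (t n))))"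
    proof (intro exI allI impI)
      fix n :: nat assume "1 \<le> n"
      then have tn: "0 < real (t n)"
        using seq_suble[OF u(2), of n] by simp
      let ?N = "norm (\<nu> (s (t n)))"
      \<comment> \<open>The sign of \<open>C\<close> is unknown. With a nonpositive numerator,
        replacing \<open>real (t n)\<close> by the larger norm can only raise the quotient.\<close>
      have "- \<bar>C\<bar> / real (t n) \<le> - \<bar>C\<bar> / ?N"
        using s(2)[of "t n"] tn by (simp add: frac_le)
      also have "\<dots> \<le> - C / ?N"
        using pos[of "t n"] by (intro divide_right_mono) auto
      also have "\<dots> \<le> (\<nu> (s (t n)) \<bullet> (A *v (y - z (s (t n))))) / ?N"
        using low[OF y] by (intro divide_right_mono) auto
      also have "\<dots> = w (t n) \<bullet> (A *v (y - z (s (t n))))"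
        by (simp add: w_def divide_inverse mult.commute)
      finally show "- \<bar>C\<bar> / real (t n) \<le> w (t n) \<bullet> (A *v (y - z (s (t n))))" .
    qed
    ultimately show ?thesis
      by (intro LIMSEQ_le[of _ 0]) auto
  qed
  \<comment> \<open>Surjectivity on the tangent cone supplies a direction \<open>d\<close> mapped to
    \<open>- u\<close>, for which the inner product with the unit vector \<open>u\<close> is
    -1.\<close>
  have "- u \<in> {A *v d | d. d \<in> tangent_cone X zs}"
    using R unfolding modified_Robinson_def by simp
  then obtain d where d: "d \<in> tangent_cone X zs" "A *v d = - u"
    by auto
  have "0 \<le> u \<bullet> (- u)"
    using tangent_cone_inner_nonneg[OF nn d(1)] d(2) by simp
  moreover have "u \<bullet> u = 1"
    using u(1) by (simp add: norm_eq_sqrt_inner)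
  ultimately show False by simp
qed


text \<open>Points outside \<open>X\<close> need no check, since \<open>g\<close> is infinite there.
  This is the passage from real inequalities on \<open>X\<close> to the extended-valued
  subdifferential.\<close>

lemma subdifferential_indicator_sum:
  fixes g\<^sub>0 :: "'a::real_inner \<Rightarrow> real"
  assumes "\<And>z. g z = ereal (g\<^sub>0 z) + indicator_fun X z" and "z \<in> X"
    and "\<And>y. y \<in> X \<Longrightarrow> g\<^sub>0 z + v \<bullet> (y - z) \<le> g\<^sub>0 y"
  shows "v \<in> subdifferential g z"
  using assms unfolding subdifferential_def indicator_fun_def by auto

section \<open>The iteration in real-valued form\<close>

text \<open>The argmin is represented by its variational inequality over \<open>X\<close>, in whose
  derivation the convexity of \<open>g\<^sub>0\<close> is spent. Extended reals return only with the
  stationarity notions.\<close>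

locale udd_alm =
  fixes f g\<^sub>0 :: "real^'n \<Rightarrow> real"
    and X :: "(real^'n) set"
    and A :: "real^'n^'m"
    and b :: "real^'m"
    and L\<^sub>f \<rho> \<rho>\<^sub>d \<theta> :: real
    and x :: "nat \<Rightarrow> real^'n"
    and \<mu> :: "nat \<Rightarrow> real^'m"
  assumes convex_X: "convex X" and compact_X: "compact X"
    and continuous_g0: "continuous_on X g\<^sub>0"
    and Lf_pos: "L\<^sub>f > 0"
    and f_differentiable: "\<And>z. z \<in> X \<Longrightarrow> f differentiable at z"
    and gradient_lipschitz: "L\<^sub>f-lipschitz_on X (gradient f)"
    and rho_nonneg: "\<rho> \<ge> 0" and rho_d_pos: "\<rho>\<^sub>d > 0" and theta_gt_1: "\<theta> > 1"
    and x_in_X: "x k \<in> X"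
    and primal_optimality: "y \<in> X \<Longrightarrow> g\<^sub>0 (x (Suc k)) \<le> g\<^sub>0 y
        + (gradient f (x k) + transpose A *v (\<mu> k + \<rho> *\<^sub>R (A *v x k - b))) \<bullet> (y - x (Suc k))
        + \<theta> * L_K L\<^sub>f \<rho> A * ((x (Suc k) - x k) \<bullet> (y - x (Suc k)))"
    and dual_step: "\<mu> (Suc k) = \<mu> k - \<rho>\<^sub>d *\<^sub>R (A *v x (Suc k) - b)"
begin

definition lagrangian :: "real^'n \<Rightarrow> real^'m \<Rightarrow> real" where
  "lagrangian z l = f z + g\<^sub>0 z + l \<bullet> (A *v z - b) + \<rho> / 2 * (norm (A *v z - b))\<^sup>2"

text \<open>The link between the two halves of the analysis: descent of the Lagrangian bounds the
  sum of these terms, and each of them bounds the stationarity error of the new iterate.\<close>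

definition progress :: "nat \<Rightarrow> real" where
  "progress k = (norm (x (Suc k) - x k))\<^sup>2 + (norm (A *v x (Suc k) - b))\<^sup>2"

definition \<delta>\<^sub>1 :: real where
  "\<delta>\<^sub>1 = min ((2 * \<theta> - 1) * L_K L\<^sub>f \<rho> A / 2) \<rho>\<^sub>d"

definition \<delta>\<^sub>2 :: real where
  "\<delta>\<^sub>2 = (\<theta> + 1) * L_K L\<^sub>f \<rho> A + (\<rho> + \<rho>\<^sub>d) * spectral_norm A"

lemma L_K_pos: "0 < L_K L\<^sub>f \<rho> A"
  unfolding L_K_def using Lf_pos rho_nonneg spectral_norm_nonneg[of "transpose A ** A"]
  by (simp add: add_pos_nonneg)

lemma delta1_pos: "0 < \<delta>\<^sub>1"
  using L_K_pos theta_gt_1 rho_d_pos by (simp add: \<delta>\<^sub>1_def)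

lemma progress_nonneg: "0 \<le> progress k"
  by (simp add: progress_def)

section \<open>Descent of the augmented Lagrangian\<close>

text \<open>Testing optimality with \<open>y = x k\<close> gains \<open>\<theta> * L_K\<close> times
  the squared step. The quadratic upper bound on the smooth part costs half of \<open>L_K\<close>
  times the same square, and the difference is the stated coefficient.\<close>

lemma lagrangian_primal_descent:
  "lagrangian (x (Suc k)) (\<mu> k) + (2 * \<theta> - 1) * L_K L\<^sub>f \<rho> A / 2 * (norm (x (Suc k) - x k))\<^sup>2
    \<le> lagrangian (x k) (\<mu> k)"
proof -
  define d where "d = x (Suc k) - x k"
  define r where "r = A *v x k - b"
  define L where "L = L_K L\<^sub>f \<rho> A"
  have xS: "x (Suc k) = x k + d" and neg: "x k - x (Suc k) = - d"
    by (auto simp: d_def)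
  have rS: "A *v x (Suc k) - b = r + A *v d"
    by (simp add: xS r_def matrix_vector_right_distrib)
  have "g\<^sub>0 (x (Suc k)) \<le> g\<^sub>0 (x k) - (gradient f (x k) + transpose A *v (\<mu> k + \<rho> *\<^sub>R r)) \<bullet> d
      - \<theta> * L * (norm d)\<^sup>2"
    using primal_optimality[OF x_in_X[of k], of k]
    unfolding neg d_def[symmetric] r_def[symmetric] L_def[symmetric]
    by (simp add: power2_norm_eq_inner)
  moreover have "(gradient f (x k) + transpose A *v (\<mu> k + \<rho> *\<^sub>R r)) \<bullet> d
      = gradient f (x k) \<bullet> d + \<mu> k \<bullet> (A *v d) + \<rho> * (r \<bullet> (A *v d))"
    by (simp only: inner_add_left inner_transpose inner_scaleR_left add.assoc)
  moreover have "f (x (Suc k)) \<le> f (x k) + gradient f (x k) \<bullet> d + L\<^sub>f / 2 * (norm d)\<^sup>2"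
    using descent_lemma[OF convex_X f_differentiable gradient_lipschitz x_in_X[of k] x_in_X[of "Suc k"]]
    by (simp add: d_def)
  moreover have "\<rho> / 2 * (norm (r + A *v d))\<^sup>2
      = \<rho> / 2 * (norm r)\<^sup>2 + \<rho> * (r \<bullet> (A *v d)) + \<rho> / 2 * (norm (A *v d))\<^sup>2"
    unfolding power2_norm_eq_inner by (simp add: inner_simps inner_commute field_simps)
  moreover have "\<rho> / 2 * (norm (A *v d))\<^sup>2 \<le> \<rho> / 2 * (spectral_norm (transpose A ** A) * (norm d)\<^sup>2)"
    using rho_nonneg by (intro mult_left_mono norm_matrix_vector_square_le) auto
  moreover have "L\<^sub>f / 2 * (norm d)\<^sup>2 + \<rho> / 2 * (spectral_norm (transpose A ** A) * (norm d)\<^sup>2)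
      = L / 2 * (norm d)\<^sup>2"
    by (simp add: L_def L_K_def field_simps)
  moreover have "(2 * \<theta> - 1) * L / 2 * (norm d)\<^sup>2 = \<theta> * L * (norm d)\<^sup>2 - L / 2 * (norm d)\<^sup>2"
    by (simp add: field_simps)
  ultimately show ?thesis
    unfolding lagrangian_def rS
    unfolding r_def[symmetric] d_def[symmetric] L_def[symmetric] inner_add_right
    by linarith
qed

lemma lagrangian_descent:
  "lagrangian (x (Suc k)) (\<mu> (Suc k)) + \<delta>\<^sub>1 * progress k \<le> lagrangian (x k) (\<mu> k)"
proof -
  \<comment> \<open>The dual step changes only the linear term, and its minus sign turns that change
    into a decrease by a multiple of the squared residual.\<close>
  have "lagrangian (x (Suc k)) (\<mu> (Suc k)) + \<rho>\<^sub>d * (norm (A *v x (Suc k) - b))\<^sup>2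
      = lagrangian (x (Suc k)) (\<mu> k)"
    unfolding lagrangian_def dual_step power2_norm_eq_inner
    by (simp add: inner_diff_left)
  moreover have "\<delta>\<^sub>1 * (norm (A *v x (Suc k) - b))\<^sup>2 \<le> \<rho>\<^sub>d * (norm (A *v x (Suc k) - b))\<^sup>2"
    by (intro mult_right_mono) (auto simp: \<delta>\<^sub>1_def)
  moreover have "\<delta>\<^sub>1 * (norm (x (Suc k) - x k))\<^sup>2
      \<le> (2 * \<theta> - 1) * L_K L\<^sub>f \<rho> A / 2 * (norm (x (Suc k) - x k))\<^sup>2"
    by (intro mult_right_mono) (auto simp: \<delta>\<^sub>1_def)
  ultimately show ?thesis
    using lagrangian_primal_descent[of k] unfolding progress_def distrib_left by linarith
qed

lemma lagrangian_telescope: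
  "\<delta>\<^sub>1 * (\<Sum>k<n. progress k) \<le> lagrangian (x 0) (\<mu> 0) - lagrangian (x n) (\<mu> n)"
proof (induction n)
  case (Suc n)
  then show ?case
    using lagrangian_descent[of n] by (simp add: distrib_left)
qed simp

lemma lagrangian_decseq: "decseq (\<lambda>k. lagrangian (x k) (\<mu> k))"
proof (rule decseq_SucI)
  fix k
  show "lagrangian (x (Suc k)) (\<mu> (Suc k)) \<le> lagrangian (x k) (\<mu> k)"
    using lagrangian_descent[of k] mult_nonneg_nonneg[OF less_imp_le[OF delta1_pos] progress_nonneg[of k]]
    by linarith
qed

section \<open>Multiplier bound and stationarity error of one step\<close>

lemma continuous_gradient: "continuous_on X (gradient f)"
  using gradient_lipschitz by (rule lipschitz_on_continuous_on)

lemma continuous_f: "continuous_on X f"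
  using f_differentiable
  by (intro differentiable_imp_continuous_on) (auto simp: differentiable_on_def intro: differentiable_at_withinI)

lemma multiplier_lower_bound:
  obtains C where "\<And>k y. y \<in> X \<Longrightarrow> - C \<le> \<mu> k \<bullet> (A *v (y - x (Suc k)))"
proof -
  \<comment> \<open>All terms of the optimality condition except the one with the multiplier, for
    \<open>p = x k\<close> and \<open>q = x (Suc k)\<close>. Compactness of \<open>X\<close> bounds
    them independently of \<open>k\<close> and \<open>y\<close>.\<close>
  define F where "F = (\<lambda>(p, q, y). g\<^sub>0 y - g\<^sub>0 q
      + (gradient f p + transpose A *v (\<rho> *\<^sub>R (A *v p - b))) \<bullet> (y - q)
      + \<theta> * L_K L\<^sub>f \<rho> A * ((q - p) \<bullet> (y - q)))"
  have "continuous_on (X \<times> X \<times> X) F"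
    unfolding F_def case_prod_unfold
    by (intro continuous_intros continuous_on_compose2[OF continuous_g0]
        continuous_on_compose2[OF continuous_gradient]
        bounded_linear.continuous_on[OF matrix_vector_mul_bounded_linear]) auto
  then have "compact (F ` (X \<times> X \<times> X))"
    by (intro compact_continuous_image compact_Times compact_X)
  then obtain C where C: "\<And>z. z \<in> X \<times> X \<times> X \<Longrightarrow> norm (F z) \<le> C"
    using compact_imp_bounded bounded_iff by (metis imageI)
  show ?thesis
  proof (rule that)
    fix k y assume y: "y \<in> X"
    have "(gradient f (x k) + transpose A *v (\<mu> k + \<rho> *\<^sub>R (A *v x k - b))) \<bullet> (y - x (Suc k))
        = \<mu> k \<bullet> (A *v (y - x (Suc k)))
          + (gradient f (x k) + transpose A *v (\<rho> *\<^sub>R (A *v x k - b))) \<bullet> (y - x (Suc k))"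
      by (simp only: inner_add_left inner_transpose)
    moreover have "\<bar>F (x k, x (Suc k), y)\<bar> \<le> C"
      using C[of "(x k, x (Suc k), y)"] y x_in_X by simp
    ultimately show "- C \<le> \<mu> k \<bullet> (A *v (y - x (Suc k)))"
      using primal_optimality[OF y, of k] unfolding F_def by simp
  qed
qed

text \<open>The first vector is the subgradient of \<open>g\<close> at the new iterate given by the
  optimality condition; the second is the one that stationarity with multiplier
  \<open>\<mu> (Suc k)\<close> asks for. Their gap bounds the distance to the
  subdifferential.\<close>

lemma step_subgradient_residual:
  "norm ((- gradient f (x k) - transpose A *v (\<mu> k + \<rho> *\<^sub>R (A *v x k - b))
        - (\<theta> * L_K L\<^sub>f \<rho> A) *\<^sub>R (x (Suc k) - x k))
      - (- gradient f (x (Suc k)) - transpose A *v \<mu> (Suc k))) \<le> \<delta>\<^sub>2 * sqrt (progress k)"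
  (is "norm ?R \<le> _")
proof -
  define d where "d = x (Suc k) - x k"
  define r where "r = A *v x (Suc k) - b"
  define L where "L = L_K L\<^sub>f \<rho> A"
  define G where "G = gradient f (x (Suc k)) - gradient f (x k)"
  have old: "A *v x k - b = r - A *v d"
    by (simp add: r_def d_def matrix_vector_mult_diff_distrib)
  \<comment> \<open>Writing the old residual as \<open>r - A *v d\<close> and inserting the dual
    step leaves only the step \<open>d\<close>, the new residual \<open>r\<close> and the gradient
    change. The penalty and the dual step each contribute a multiple of
    \<open>transpose A *v r\<close>, hence the factor
    \<open>\<rho> + \<rho>\<^sub>d\<close>.\<close>
  have R: "?R = G - (\<theta> * L) *\<^sub>R d + \<rho> *\<^sub>R ((transpose A ** A) *v d) - (\<rho> + \<rho>\<^sub>d) *\<^sub>R (transpose A *v r)"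
    unfolding dual_step old r_def[symmetric] d_def[symmetric] L_def[symmetric] G_def
    by (simp add: matrix_vector_right_distrib matrix_vector_mult_diff_distrib matrix_vector_mult_scaleR
        matrix_vector_mul_assoc[symmetric] algebra_simps)
  have tri: "norm (u - v + w - z) \<le> norm u + norm v + norm w + norm z" for u v w z :: "real^'n"
    by norm
  have dle: "norm d \<le> sqrt (progress k)" and rle: "norm r \<le> sqrt (progress k)"
    by (auto intro!: real_le_rsqrt simp: progress_def d_def r_def)
  have "norm G \<le> L\<^sub>f * norm d"
    using lipschitz_onD[OF gradient_lipschitz x_in_X[of "Suc k"] x_in_X[of k]]
    by (simp add: G_def d_def dist_norm)
  moreover have "norm ((\<theta> * L) *\<^sub>R d) = \<theta> * L * norm d"
    using L_K_pos theta_gt_1 by (simp add: L_def)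
  moreover have "norm (\<rho> *\<^sub>R ((transpose A ** A) *v d)) \<le> \<rho> * (spectral_norm (transpose A ** A) * norm d)"
    using rho_nonneg by (simp add: mult_left_mono norm_matrix_vector_le)
  moreover have "norm ((\<rho> + \<rho>\<^sub>d) *\<^sub>R (transpose A *v r)) \<le> (\<rho> + \<rho>\<^sub>d) * (spectral_norm A * norm r)"
    using rho_nonneg rho_d_pos norm_transpose_vector_le[of A r] by (simp add: mult_left_mono)
  moreover have "norm ?R \<le> norm G + norm ((\<theta> * L) *\<^sub>R d)
      + norm (\<rho> *\<^sub>R ((transpose A ** A) *v d)) + norm ((\<rho> + \<rho>\<^sub>d) *\<^sub>R (transpose A *v r))"
    unfolding R by (rule tri)
  \<comment> \<open>The gradient change and the penalty part together contribute one further
    \<open>L_K\<close>, whence the factor \<open>\<theta> + 1\<close>.\<close>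
  moreover have "L\<^sub>f * norm d + \<theta> * L * norm d + \<rho> * (spectral_norm (transpose A ** A) * norm d)
      = (\<theta> + 1) * L * norm d"
    by (simp add: L_def L_K_def algebra_simps)
  moreover have "(\<theta> + 1) * L * norm d \<le> (\<theta> + 1) * L * sqrt (progress k)"
    using dle L_K_pos theta_gt_1 by (intro mult_left_mono) (auto simp: L_def)
  moreover have "(\<rho> + \<rho>\<^sub>d) * (spectral_norm A * norm r) \<le> (\<rho> + \<rho>\<^sub>d) * (spectral_norm A * sqrt (progress k))"
    using rle rho_nonneg rho_d_pos by (intro mult_left_mono) (auto simp: spectral_norm_nonneg)
  moreover have "\<delta>\<^sub>2 * sqrt (progress k)
      = (\<theta> + 1) * L * sqrt (progress k) + (\<rho> + \<rho>\<^sub>d) * (spectral_norm A * sqrt (progress k))"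
    by (simp add: \<delta>\<^sub>2_def L_def algebra_simps)
  ultimately show ?thesis by linarith
qed

text \<open>The factor 1 in the maximum covers feasibility and \<open>\<delta>\<^sub>2\<close>
  covers the subdifferential condition, witnessed by the multiplier
  \<open>\<mu> (Suc k)\<close>.\<close>

lemma eps_stationary_step:
  assumes g: "\<And>z. g z = ereal (g\<^sub>0 z) + indicator_fun X z"
    and le: "max 1 \<delta>\<^sub>2 * sqrt (progress k) \<le> \<epsilon>"
  shows "eps_stationary f g X A b \<epsilon> (x (Suc k))"
proof -
  let ?v = "- gradient f (x k) - transpose A *v (\<mu> k + \<rho> *\<^sub>R (A *v x k - b))
        - (\<theta> * L_K L\<^sub>f \<rho> A) *\<^sub>R (x (Suc k) - x k)"
  have v: "?v \<in> subdifferential g (x (Suc k))"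
  proof (rule subdifferential_indicator_sum[OF g x_in_X])
    fix y assume y: "y \<in> X"
    show "g\<^sub>0 (x (Suc k)) + ?v \<bullet> (y - x (Suc k)) \<le> g\<^sub>0 y"
      using primal_optimality[OF y, of k]
      by (simp only: inner_add_left inner_diff_left inner_minus_left inner_scaleR_left)
  qed
  have sq: "0 \<le> sqrt (progress k)"
    using progress_nonneg by simp
  have "\<delta>\<^sub>2 * sqrt (progress k) \<le> max 1 \<delta>\<^sub>2 * sqrt (progress k)"
    "1 * sqrt (progress k) \<le> max 1 \<delta>\<^sub>2 * sqrt (progress k)"
    using sq by (intro mult_right_mono; simp)+
  then have bnd: "\<delta>\<^sub>2 * sqrt (progress k) \<le> \<epsilon>" "sqrt (progress k) \<le> \<epsilon>"
    using le by auto
  have "norm (A *v x (Suc k) - b) \<le> sqrt (progress k)"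
    by (auto intro!: real_le_rsqrt simp: progress_def)
  then have "norm (A *v x (Suc k) - b) \<le> \<epsilon>"
    using bnd by linarith
  moreover have "dist_to_set (- gradient f (x (Suc k)) - transpose A *v \<mu> (Suc k))
      (subdifferential g (x (Suc k))) \<le> ereal \<epsilon>"
    unfolding dist_to_set_def
    using step_subgradient_residual[of k] bnd by (intro INF_lower2[OF v]) simp
  ultimately show ?thesis
    unfolding eps_stationary_def using x_in_X by blast
qed

section \<open>Limit points\<close>

lemma limit_point:
  assumes r: "strict_mono r" "(x \<circ> r) \<longlonglongrightarrow> xs" and R: "modified_Robinson X A xs"
    and g: "\<And>z. g z = ereal (g\<^sub>0 z) + indicator_fun X z"
  shows "stationary f g X A b xs" and "f xs + g\<^sub>0 xs \<le> lagrangian (x k) (\<mu> k)"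
proof -
  have xs: "xs \<in> X"
    using R by (simp add: modified_Robinson_def)
  \<comment> \<open>The multiplier bound pairs \<open>\<mu> k\<close> with \<open>x (Suc k)\<close>,
    so the subsequence is shifted back by one. Dropping its first index guarantees a
    predecessor.\<close>
  define q where "q j = r (Suc j) - 1" for j
  have rq: "r (Suc j) = Suc (q j)" for j
    using seq_suble[OF r(1), of "Suc j"] by (simp add: q_def)
  have q: "strict_mono q"
  proof (rule strict_monoI)
    fix i j :: nat assume "i < j"
    then have "r (Suc i) < r (Suc j)"
      using r(1) by (simp add: strict_mono_less)
    then show "q i < q j" by (simp add: rq)
  qed
  have xq: "(\<lambda>j. x (Suc (q j))) \<longlonglongrightarrow> xs"
    using LIMSEQ_Suc[OF r(2)] by (simp add: rq)
  obtain C where "\<And>k y. y \<in> X \<Longrightarrow> - C \<le> \<mu> k \<bullet> (A *v (y - x (Suc k)))"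
    using multiplier_lower_bound by blast
  then have "bounded (range (\<lambda>j. \<mu> (q j)))"
    by (intro modified_Robinson_bounded_multipliers[OF R xq])
  then obtain l s where s: "strict_mono (s :: nat \<Rightarrow> nat)" "((\<lambda>j. \<mu> (q j)) \<circ> s) \<longlonglongrightarrow> l"
    using bounded_imp_convergent_subsequence by blast
  define p where "p = q \<circ> s"
  have p: "strict_mono p"
    unfolding p_def by (rule strict_mono_o[OF q s(1)])
  have mup: "(\<lambda>j. \<mu> (p j)) \<longlonglongrightarrow> l"
    using s(2) by (simp add: p_def o_def)
  have xp: "(\<lambda>j. x (Suc (p j))) \<longlonglongrightarrow> xs"
    using LIMSEQ_subseq_LIMSEQ[OF xq s(1)] by (simp add: p_def o_def)
  note mat = bounded_linear.tendsto[OF matrix_vector_mul_bounded_linear]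
  note cont = continuous_on_tendsto_compose[OF _ _ xs]
  \<comment> \<open>Feasibility of \<open>xs\<close> is not known yet, so the limit of the updated
    multipliers still carries the residual.\<close>
  have lag_lim: "(\<lambda>j. lagrangian (x (Suc (p j))) (\<mu> (Suc (p j))))
      \<longlonglongrightarrow> lagrangian xs (l - \<rho>\<^sub>d *\<^sub>R (A *v xs - b))" (is "_ \<longlonglongrightarrow> ?\<Lambda>")
    unfolding lagrangian_def dual_step
    by (intro tendsto_intros mat xp mup cont[OF continuous_f] cont[OF continuous_g0]) (auto simp: x_in_X)
  have lag_ge: "?\<Lambda> \<le> lagrangian (x k) (\<mu> k)" for k
  proof (rule LIMSEQ_le_const2[OF lag_lim], intro exI allI impI)
    fix j assume "k \<le> j"
    then have "k \<le> Suc (p j)"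
      using seq_suble[OF p, of j] by simp
    then show "lagrangian (x (Suc (p j))) (\<mu> (Suc (p j))) \<le> lagrangian (x k) (\<mu> k)"
      using lagrangian_decseq by (auto simp: decseq_def)
  qed
  \<comment> \<open>The Lagrangian is now bounded below along the whole sequence, so
    \<open>progress\<close> is summable and tends to 0.\<close>
  have "(\<Sum>k<n. progress k) \<le> (lagrangian (x 0) (\<mu> 0) - ?\<Lambda>) / \<delta>\<^sub>1" for n
    using lagrangian_telescope[of n] lag_ge[of n] delta1_pos
    by (simp add: field_simps)
  then have "summable progress"
    by (intro summableI_nonneg_bounded progress_nonneg)
  then have "progress \<longlonglongrightarrow> 0"
    by (rule summable_LIMSEQ_zero)
  then have pr: "(\<lambda>j. sqrt (progress (p j))) \<longlonglongrightarrow> 0"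
    using tendsto_real_sqrt[OF LIMSEQ_subseq_LIMSEQ[OF _ p]] by (fastforce simp: o_def)
  have d0: "(\<lambda>j. x (Suc (p j)) - x (p j)) \<longlonglongrightarrow> 0"
    by (rule Lim_null_comparison[OF _ pr])
       (auto intro!: always_eventually real_le_rsqrt simp: progress_def)
  have r0: "(\<lambda>j. A *v x (Suc (p j)) - b) \<longlonglongrightarrow> 0"
    by (rule Lim_null_comparison[OF _ pr])
       (auto intro!: always_eventually real_le_rsqrt simp: progress_def)
  have "(\<lambda>j. A *v x (Suc (p j)) - b) \<longlonglongrightarrow> A *v xs - b"
    by (intro tendsto_intros mat xp)
  with r0 have "A *v xs - b = 0"
    using LIMSEQ_unique by blast
  then have feas: "A *v xs = b" by simp
  \<comment> \<open>At a feasible point both constraint terms vanish, whatever the limit multiplier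
    is.\<close>
  show "f xs + g\<^sub>0 xs \<le> lagrangian (x k) (\<mu> k)"
    using lag_ge[of k] by (simp add: lagrangian_def feas)
  \<comment> \<open>The optimality condition also involves the previous iterate, which has the same
    limit because the steps vanish.\<close>
  have xp0: "(\<lambda>j. x (p j)) \<longlonglongrightarrow> xs"
    using tendsto_diff[OF xp d0] by simp
  have "- gradient f xs - transpose A *v l \<in> subdifferential g xs"
  proof (rule subdifferential_indicator_sum[OF g xs])
    fix y assume y: "y \<in> X"
    have lhs: "(\<lambda>j. g\<^sub>0 (x (Suc (p j)))) \<longlonglongrightarrow> g\<^sub>0 xs"
      by (intro cont[OF continuous_g0] xp) (auto simp: x_in_X)
    have rhs: "(\<lambda>j. g\<^sub>0 y
        + (gradient f (x (p j)) + transpose A *v (\<mu> (p j) + \<rho> *\<^sub>R (A *v x (p j) - b))) \<bullet> (y - x (Suc (p j)))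
        + \<theta> * L_K L\<^sub>f \<rho> A * ((x (Suc (p j)) - x (p j)) \<bullet> (y - x (Suc (p j)))))
      \<longlonglongrightarrow> g\<^sub>0 y + (gradient f xs + transpose A *v (l + \<rho> *\<^sub>R (A *v xs - b))) \<bullet> (y - xs)
        + \<theta> * L_K L\<^sub>f \<rho> A * (0 \<bullet> (y - xs))"
      by (intro tendsto_intros mat xp xp0 mup d0 cont[OF continuous_gradient]) (auto simp: x_in_X)
    have "g\<^sub>0 xs \<le> g\<^sub>0 y + (gradient f xs + transpose A *v (l + \<rho> *\<^sub>R (A *v xs - b))) \<bullet> (y - xs)
        + \<theta> * L_K L\<^sub>f \<rho> A * (0 \<bullet> (y - xs))"
      by (rule LIMSEQ_le[OF lhs rhs]) (use primal_optimality[OF y] in auto)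
    then show "g\<^sub>0 xs + (- gradient f xs - transpose A *v l) \<bullet> (y - xs) \<le> g\<^sub>0 y"
      by (simp add: feas inner_add_left inner_diff_left)
  qed
  then show "stationary f g X A b xs"
    unfolding stationary_def using xs feas by blast
qed

section \<open>Iteration complexity\<close>

lemma iteration_complexity:
  assumes g: "\<And>z. g z = ereal (g\<^sub>0 z) + indicator_fun X z"
    and low: "\<And>k. \<Lambda> \<le> lagrangian (x k) (\<mu> k)" and "\<epsilon> > 0"
  shows "\<exists>K::nat. int K \<le> \<lceil>(max 1 \<delta>\<^sub>2)\<^sup>2 * (lagrangian (x 0) (\<mu> 0) - \<Lambda>) / (\<delta>\<^sub>1 * \<epsilon>\<^sup>2)\<rceil>
    \<and> (\<exists>k\<le>K. eps_stationary f g X A b \<epsilon> (x k))"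
proof -
  define M where "M = max 1 \<delta>\<^sub>2"
  define \<Delta> where "\<Delta> = lagrangian (x 0) (\<mu> 0) - \<Lambda>"
  define B where "B = M\<^sup>2 * \<Delta> / (\<delta>\<^sub>1 * \<epsilon>\<^sup>2)"
  define K where "K = nat \<lceil>B\<rceil>"
  have M: "1 \<le> M" by (simp add: M_def)
  have \<Delta>: "0 \<le> \<Delta>" using low[of 0] by (simp add: \<Delta>_def)
  have "0 \<le> B"
    unfolding B_def using \<Delta> delta1_pos by simp
  then have K: "int K = \<lceil>B\<rceil>" by (simp add: K_def)
  have tel: "\<delta>\<^sub>1 * (\<Sum>k<n. progress k) \<le> \<Delta>" for n
    using lagrangian_telescope[of n] low[of n] by (simp add: \<Delta>_def)
  have "\<exists>k\<le>K. eps_stationary f g X A b \<epsilon> (x k)"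
  proof (cases "\<Delta> = 0")
    case True
    \<comment> \<open>The bound is then 0, but no progress is made in the first step, so \<open>x\<^sup>0 = x\<^sup>1\<close>.\<close>
    have "progress 0 = 0"
      using tel[of 1] True delta1_pos progress_nonneg[of 0] by (simp add: mult_le_0_iff)
    moreover have "x (Suc 0) = x 0"
      using \<open>progress 0 = 0\<close> by (simp add: progress_def add_nonneg_eq_0_iff)
    ultimately have "eps_stationary f g X A b \<epsilon> (x 0)"
      using eps_stationary_step[OF g, of 0 \<epsilon>] \<open>\<epsilon> > 0\<close> by simp
    then show ?thesis by blast
  next
    case False
    with \<Delta> have "0 < \<Delta>" by simp
    then have "0 < B"
      unfolding B_def using M delta1_pos \<open>\<epsilon> > 0\<close> by simp
    \<comment> \<open>A nonempty range of summation is what keeps the inequality strict when the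
      terms are summed below.\<close>
    then have "0 < K" by (simp add: K_def)
    have "\<exists>k<K. M\<^sup>2 * progress k \<le> \<epsilon>\<^sup>2"
    proof (rule ccontr)
      assume "\<not> ?thesis"
      then have "\<And>k. k \<in> {..<K} \<Longrightarrow> \<epsilon>\<^sup>2 < M\<^sup>2 * progress k"
        by (auto simp: not_le)
      then have "(\<Sum>k<K. \<epsilon>\<^sup>2) < (\<Sum>k<K. M\<^sup>2 * progress k)"
        using \<open>0 < K\<close> by (intro sum_strict_mono) auto
      then have "\<delta>\<^sub>1 * (K * \<epsilon>\<^sup>2) < \<delta>\<^sub>1 * (M\<^sup>2 * (\<Sum>k<K. progress k))"
        using delta1_pos by (simp add: sum_distrib_left[symmetric])
      also have "\<dots> = M\<^sup>2 * (\<delta>\<^sub>1 * (\<Sum>k<K. progress k))"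
        by (simp add: mult_ac)
      also have "\<dots> \<le> M\<^sup>2 * \<Delta>"
        by (intro mult_left_mono tel) auto
      finally have "real K < B"
        using delta1_pos \<open>\<epsilon> > 0\<close> by (simp add: B_def field_simps)
      moreover have "B \<le> real K"
        using K by (metis le_of_int_ceiling of_int_of_nat_eq)
      ultimately show False by simp
    qed
    then obtain k where k: "k < K" "M\<^sup>2 * progress k \<le> \<epsilon>\<^sup>2" by blast
    have "M * sqrt (progress k) = sqrt (M\<^sup>2 * progress k)"
      using M by (simp add: real_sqrt_mult)
    also have "\<dots> \<le> \<epsilon>"
      using k(2) \<open>\<epsilon> > 0\<close> by (simp add: real_le_lsqrt)
    finally have "eps_stationary f g X A b \<epsilon> (x (Suc k))"
      by (intro eps_stationary_step[OF g]) (simp add: M_def)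
    \<comment> \<open>Small progress in step \<open>k\<close> certifies the iterate
      \<open>Suc k\<close>; since \<open>k < K\<close>, this index is still at most
      \<open>K\<close>.\<close>
    then show ?thesis
      using k(1) by (intro exI[of _ "Suc k"]) simp
  qed
  then show ?thesis
    using K unfolding B_def M_def \<Delta>_def by (intro exI[of _ K]) simp
qed

end

text \<open>Rounding up costs at most 1, which \<open>1 / \<epsilon>\<^sup>2\<close> dominates for
  \<open>\<epsilon> < 1\<close>.\<close>

lemma ceiling_over_square_bigo:
  "(\<lambda>\<epsilon>::real. real_of_int \<lceil>a / (c * \<epsilon>\<^sup>2)\<rceil>) \<in> O[at_right 0](\<lambda>\<epsilon>. 1 / \<epsilon>\<^sup>2)"
proof (rule bigoI[of _ "\<bar>a / c\<bar> + 1"])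
  have "norm (real_of_int \<lceil>a / (c * \<epsilon>\<^sup>2)\<rceil>) \<le> (\<bar>a / c\<bar> + 1) * norm (1 / \<epsilon>\<^sup>2)"
    if "0 < \<epsilon>" "\<epsilon> < 1" for \<epsilon> :: real
  proof -
    let ?B = "a / (c * \<epsilon>\<^sup>2)"
    have "\<bar>real_of_int \<lceil>?B\<rceil>\<bar> \<le> \<bar>?B\<bar> + 1"
      by linarith
    moreover have "\<bar>?B\<bar> = \<bar>a / c\<bar> * (1 / \<epsilon>\<^sup>2)"
      by (simp add: abs_mult)
    moreover have "1 \<le> 1 / \<epsilon>\<^sup>2"
      using that by (simp add: power_le_one)
    ultimately have "\<bar>real_of_int \<lceil>?B\<rceil>\<bar> \<le> (\<bar>a / c\<bar> + 1) * (1 / \<epsilon>\<^sup>2)"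
      unfolding distrib_right by linarith
    then show ?thesis by simp
  qed
  then show "\<forall>\<^sub>F \<epsilon> in at_right 0. norm (real_of_int \<lceil>a / (c * \<epsilon>\<^sup>2)\<rceil>) \<le> (\<bar>a / c\<bar> + 1) * norm (1 / \<epsilon>\<^sup>2)"
    unfolding eventually_at_right_field by (intro exI[of _ 1]) auto
qed

section \<open>Transfer to the extended-valued problem\<close>

theorem theorem4p6:
  fixes f g\<^sub>0 :: "real^'n \<Rightarrow> real"
    and g :: "real^'n \<Rightarrow> ereal"
    and X :: "(real^'n) set"
    and A :: "real^'n^'m"
    and b :: "real^'m"
    and L\<^sub>f \<rho> \<rho>\<^sub>d \<theta> :: real
    and x :: "nat \<Rightarrow> real^'n"
    and \<mu> :: "nat \<Rightarrow> real^'m"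
    and xstar :: "real^'n"
  defines "\<delta>\<^sub>1 \<equiv> min ((2 * \<theta> - 1) * L_K L\<^sub>f \<rho> A / 2) \<rho>\<^sub>d"
    and "\<delta>\<^sub>2 \<equiv> (\<theta> + 1) * L_K L\<^sub>f \<rho> A + (\<rho> + \<rho>\<^sub>d) * spectral_norm A"
  defines "bound \<equiv> \<lambda>\<epsilon>::real.
      \<lceil>(max 1 \<delta>\<^sub>2)\<^sup>2 *
         real_of_ereal (augmented_Lagrangian f g A b \<rho> (x 0) (\<mu> 0) - ereal (f xstar) - g xstar)
       / (\<delta>\<^sub>1 * \<epsilon>\<^sup>2)\<rceil>"
  assumes "convex X" "compact X"
    and "continuous_on X g\<^sub>0" "convex_on X g\<^sub>0"
    and "\<And>z. g z = ereal (g\<^sub>0 z) + indicator_fun X z"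
    and "L\<^sub>f > 0" "\<And>z. z \<in> X \<Longrightarrow> f differentiable at z" "L\<^sub>f-lipschitz_on X (gradient f)"
    and "X \<inter> {z. A *v z = b} \<noteq> {}"
    and "x 0 \<in> X" "\<rho> \<ge> 0" "\<rho>\<^sub>d > 0" "\<theta> > 1"
    and "UDD_ALM f g A b L\<^sub>f \<rho> \<rho>\<^sub>d \<theta> x \<mu>"
    and "\<exists>r. strict_mono r \<and> (x \<circ> r) \<longlonglongrightarrow> xstar"
    and "modified_Robinson X A xstar"
  shows "stationary f g X A b xstar
    \<and> (\<forall>\<epsilon>>0. \<exists>K::nat. int K \<le> bound \<epsilon> \<and> (\<exists>k\<le>K. eps_stationary f g X A b \<epsilon> (x k)))
    \<and> (\<lambda>\<epsilon>. real_of_int (bound \<epsilon>)) \<in> O[at_right 0](\<lambda>\<epsilon>. 1 / \<epsilon>\<^sup>2)"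
proof -
  have gX: "g z = ereal (g\<^sub>0 z)" if "z \<in> X" for z
    using that assms(8) by (simp add: indicator_fun_def)
  have g_out: "g z = \<infinity>" if "z \<notin> X" for z
    using that assms(8) by (simp add: indicator_fun_def)
  let ?v = "\<lambda>k. gradient f (x k) + transpose A *v (\<mu> k + \<rho> *\<^sub>R (A *v x k - b))"
  let ?c = "\<theta> * L_K L\<^sub>f \<rho> A"
  have step: "g (x (Suc k)) + ereal (?v k \<bullet> (x (Suc k) - x k)) + ereal (?c / 2 * (norm (x (Suc k) - x k))\<^sup>2)
      \<le> g z + ereal (?v k \<bullet> (z - x k)) + ereal (?c / 2 * (norm (z - x k))\<^sup>2)" for k z
    using assms(17) unfolding UDD_ALM_def is_arg_min_def by (meson not_le)
  have dual: "\<mu> (Suc k) = \<mu> k - \<rho>\<^sub>d *\<^sub>R (A *v x (Suc k) - b)" for k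
    using assms(17) unfolding UDD_ALM_def by blast
  have xX: "x k \<in> X" for k
  proof (cases k)
    case 0
    then show ?thesis using assms(13) by simp
  next
    case (Suc j)
    \<comment> \<open>The subproblem has a finite value at \<open>x 0\<close>, so its minimizer
      cannot lie outside \<open>X\<close>.\<close>
    have "g (x k) \<noteq> \<infinity>"
      using step[of j "x 0"] gX[OF assms(13)] unfolding Suc by auto
    then show ?thesis using g_out by blast
  qed
  interpret udd_alm f g\<^sub>0 X A b L\<^sub>f \<rho> \<rho>\<^sub>d \<theta> x \<mu>
  proof
    fix k y assume y: "y \<in> X"
    show "g\<^sub>0 (x (Suc k)) \<le> g\<^sub>0 y + ?v k \<bullet> (y - x (Suc k)) + ?c * ((x (Suc k) - x k) \<bullet> (y - x (Suc k)))"
    proof (rule proximal_step_optimality[OF assms(4,7) xX y])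
      fix z assume "z \<in> X"
      then show "g\<^sub>0 (x (Suc k)) + ?v k \<bullet> (x (Suc k) - x k) + ?c / 2 * (norm (x (Suc k) - x k))\<^sup>2
          \<le> g\<^sub>0 z + ?v k \<bullet> (z - x k) + ?c / 2 * (norm (z - x k))\<^sup>2"
        using step[of k z] by (simp add: gX xX)
    qed
  qed (use assms xX dual in auto)
  obtain r where r: "strict_mono r" "(x \<circ> r) \<longlonglongrightarrow> xstar"
    using assms(18) by blast
  have "xstar \<in> X"
    using assms(19) by (simp add: modified_Robinson_def)
  \<comment> \<open>Both points lie in \<open>X\<close>, so every extended real here is finite and
    \<open>real_of_ereal\<close> does not fall back to its default value.\<close>
  then have gap: "real_of_ereal (augmented_Lagrangian f g A b \<rho> (x 0) (\<mu> 0) - ereal (f xstar) - g xstar)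
      = lagrangian (x 0) (\<mu> 0) - (f xstar + g\<^sub>0 xstar)"
    by (simp add: augmented_Lagrangian_def lagrangian_def gX xX)
  have bound: "bound = (\<lambda>\<epsilon>. \<lceil>(max 1 local.\<delta>\<^sub>2)\<^sup>2 * (lagrangian (x 0) (\<mu> 0) - (f xstar + g\<^sub>0 xstar))
      / (local.\<delta>\<^sub>1 * \<epsilon>\<^sup>2)\<rceil>)"
    unfolding assms(1-3) gap local.\<delta>\<^sub>1_def local.\<delta>\<^sub>2_def ..
  note lim = limit_point[OF r assms(19,8)]
  show ?thesis
    unfolding bound
    using lim(1) iteration_complexity[OF assms(8) lim(2)] ceiling_over_square_bigo by blast
qed

end
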